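(* Let $F$ be a field with $\operatorname{char}(F)\neq 2$ and let $L$ be a $4$-dimensional nilpotent Lie algebra over $F$ with $b(L)=2$. Then $L$ has a basis $\{x_1,x_2,x_3,z\}$ with $[x_1,x_2]=x_3$, $[x_1,x_3]=z$, and all other brackets of basis vectors (apart from those determined by antisymmetry) equal to zero.
   Context: For a finite dimensional Lie algebra $L$ and $x\in L$, $\operatorname{ad}_x:L\to L$ denotes the map $y\mapsto [x,y]$. The breadth of $L$ is $b(L)=\max\{\operatorname{rank}(\operatorname{ad}_x)\mid x\in L\}$. *)

theory Defs
  imports Complex_Main
begin

text \<open>The underlying vector space of the Lie algebra is the whole type \<open>'v\<close>.\<close>

locale lie_algebra = vector_space scale
  for scale :: "'f::field \<Rightarrow> 'v::ab_group_add \<Rightarrow> 'v" +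
  fixes bracket :: "'v \<Rightarrow> 'v \<Rightarrow> 'v"
  assumes linear_bracket_left: "Vector_Spaces.linear scale scale (\<lambda>x. bracket x y)"
    and linear_bracket_right: "Vector_Spaces.linear scale scale (\<lambda>y. bracket x y)"
    and bracket_self: "bracket x x = 0"
    and jacobi: "bracket x (bracket y z) + bracket y (bracket z x) + bracket z (bracket x y) = 0"
begin

definition ad :: "'v \<Rightarrow> 'v \<Rightarrow> 'v"
  where "ad x = (\<lambda>y. bracket x y)"

text \<open>The maximum is that of a nonempty set, which is finite (ranks being bounded by the
  dimension) when the Lie algebra is finite dimensional; otherwise it may be unspecified.\<close>

definition breadth :: nat
  where "breadth = Max (range (\<lambda>x. dim (range (ad x))))"

text \<open>\<open>lower_central k\<close> is the term \<open>L\<^sup>k\<^sup>+\<^sup>1\<close> of the lower central series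
  \<open>L\<^sup>1 = L\<close>, \<open>L\<^sup>i\<^sup>+\<^sup>1 = [L, L\<^sup>i]\<close>, where \<open>[L, L\<^sup>i]\<close> is the span of all brackets.\<close>

primrec lower_central :: "nat \<Rightarrow> 'v set"
  where
    "lower_central 0 = UNIV"
  | "lower_central (Suc k) = span {bracket x y | x y. y \<in> lower_central k}"

definition nilpotent :: bool
  where "nilpotent \<longleftrightarrow> (\<exists>k. lower_central k = {0})"

end

end

theory Submission
  imports Defs
begin

text \<open>
  Nilpotency enters only through \<open>self_reproducing_trivial\<close>: a set \<open>A\<close> with
  \<open>A \<subseteq> span [L, A]\<close> lies in every term of the lower central series, so it contains at most \<open>0\<close>.
  In particular no equation \<open>v = [u, v]\<close> or \<open>v = a [u, [u, v]]\<close> holds for \<open>v \<noteq> 0\<close>.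

  Let \<open>ad\<^sub>x\<close> have rank \<open>2\<close>. If \<open>ad\<^sub>x\<^sup>2 = 0\<close>, then \<open>ad\<^sub>x\<close> would kill its two-dimensional image as well
  as \<open>x\<close>. Its kernel also has dimension \<open>2\<close>, so \<open>x\<close> would be in the image, say
  \<open>x = [x, u] = - [u, x]\<close>, which is impossible. So some \<open>y\<close> has \<open>z = [x, w] \<noteq> 0\<close> for \<open>w = [x, y]\<close>.
  The image of \<open>ad\<^sub>x\<close> is then spanned by \<open>w\<close> and \<open>z\<close>, nilpotency gives \<open>[x, z] = 0\<close>, and
  \<open>x, y, w, z\<close> form a basis. Writing \<open>[y, w] = a x + b y + c w + d z\<close>, the Jacobi identity
  yields \<open>[y, z] = b w + c z\<close> and \<open>[w, z] = b z\<close>. Nilpotency then forces \<open>b = 0\<close>, \<open>c = 0\<close> and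
  \<open>a = 0\<close>, in this order. The remaining bracket \<open>[y, w] = d z\<close> is removed by replacing
  \<open>y\<close> by \<open>y - d x\<close>.
\<close>

context lie_algebra
begin

lemma bracket_add_left: "bracket (a + b) c = bracket a c + bracket b c"
  and bracket_scale_left: "bracket (scale k a) c = scale k (bracket a c)"
  and bracket_diff_left: "bracket (a - b) c = bracket a c - bracket b c"
  and bracket_minus_left: "bracket (- a) c = - bracket a c"
  and bracket_zero_left: "bracket 0 c = 0"
proof -
  interpret l: Vector_Spaces.linear scale scale "\<lambda>x. bracket x c"
    by (rule linear_bracket_left)
  show "bracket (a + b) c = bracket a c + bracket b c" by (rule l.add)
  show "bracket (scale k a) c = scale k (bracket a c)" by (rule l.scale)
  show "bracket (a - b) c = bracket a c - bracket b c" by (rule l.diff)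
  show "bracket (- a) c = - bracket a c" by (rule l.neg)
  show "bracket 0 c = 0" by (rule l.zero)
qed

lemma bracket_add_right: "bracket c (a + b) = bracket c a + bracket c b"
  and bracket_scale_right: "bracket c (scale k a) = scale k (bracket c a)"
  and bracket_diff_right: "bracket c (a - b) = bracket c a - bracket c b"
  and bracket_minus_right: "bracket c (- a) = - bracket c a"
  and bracket_zero_right: "bracket c 0 = 0"
proof -
  interpret l: Vector_Spaces.linear scale scale "bracket c"
    using linear_bracket_right[of c] by simp
  show "bracket c (a + b) = bracket c a + bracket c b" by (rule l.add)
  show "bracket c (scale k a) = scale k (bracket c a)" by (rule l.scale)
  show "bracket c (a - b) = bracket c a - bracket c b" by (rule l.diff)
  show "bracket c (- a) = - bracket c a" by (rule l.neg)
  show "bracket c 0 = 0" by (rule l.zero)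
qed

lemmas bracket_bilinear =
  bracket_add_left bracket_scale_left bracket_diff_left
  bracket_minus_left bracket_zero_left
  bracket_add_right bracket_scale_right bracket_diff_right
  bracket_minus_right bracket_zero_right

lemma bracket_antisym: "bracket a b = - bracket b a"
proof -
  have "bracket (a + b) (a + b) = bracket a b + bracket b a"
    by (simp only: bracket_add_left bracket_add_right) (simp add: bracket_self)
  then have "bracket a b + bracket b a = 0" by (simp add: bracket_self)
  then show ?thesis by (simp add: eq_neg_iff_add_eq_0)
qed

lemma subspace_range_ad: "subspace (range (bracket u))"
  and subspace_ker_ad: "subspace {v. bracket u v = 0}"
proof -
  have "0 \<in> range (bracket u)" by (rule range_eqI[of _ _ 0]) (simp add: bracket_zero_right)
  then show "subspace (range (bracket u))"
    by (auto simp: subspace_def simp flip: bracket_add_right bracket_scale_right)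
  show "subspace {v. bracket u v = 0}"
    by (auto simp: subspace_def bracket_bilinear)
qed

lemma span_subset_ker_ad:
  assumes "\<And>v. v \<in> S \<Longrightarrow> bracket u v = 0" and "v \<in> span S"
  shows "bracket u v = 0"
  using span_minimal[OF _ subspace_ker_ad, of S u] assms by auto

text \<open>
  This is the form in which nilpotency is used: \<open>A \<subseteq> [L, A]\<close> makes membership in \<open>L\<^sup>k\<close> pass on to
  \<open>L\<^sup>k\<^sup>+\<^sup>1\<close> for all elements of \<open>A\<close> simultaneously.
\<close>

lemma self_reproducing_trivial:
  assumes "nilpotent"
    and A: "A \<subseteq> span {bracket u a | u a. a \<in> A}"
  shows "A \<subseteq> {0}"
proof -
  have "A \<subseteq> lower_central k" for k
  proof (induction k)
    case (Suc k)
    have "span {bracket u a | u a. a \<in> A} \<subseteq> lower_central (Suc k)"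
      using Suc by (auto intro!: span_mono)
    with A show ?case by blast
  qed simp
  with \<open>nilpotent\<close> show ?thesis unfolding nilpotent_def by metis
qed

lemma ad_no_eigenvector:
  assumes "nilpotent" and "v = bracket u (scale k v)"
  shows "v = 0"
proof -
  have "bracket u v \<in> span {bracket u a | u a. a \<in> {v}}"
    by (intro span_base) blast
  then have "scale k (bracket u v) \<in> span {bracket u a | u a. a \<in> {v}}"
    by (rule span_scale)
  moreover have "scale k (bracket u v) = v"
    using assms(2) by (simp only: bracket_scale_right)
  ultimately have "{v} \<subseteq> span {bracket u a | u a. a \<in> {v}}" by simp
  then show ?thesis using self_reproducing_trivial[OF assms(1)] by blast
qed

lemma ad_square_no_eigenvector:
  assumes "nilpotent" and v: "v = scale k (bracket u (bracket u v))"
  shows "v = 0"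
proof -
  let ?A = "{v, bracket u v}"
  have gen: "bracket u a \<in> span {bracket u a | u a. a \<in> ?A}" if "a \<in> ?A" for a
    using that by (intro span_base) blast
  have "scale k (bracket u (bracket u v)) \<in> span {bracket u a | u a. a \<in> ?A}"
    by (intro span_scale gen) simp
  then have "v \<in> span {bracket u a | u a. a \<in> ?A}" by (simp only: v[symmetric])
  then have "?A \<subseteq> span {bracket u a | u a. a \<in> ?A}" using gen by blast
  then show ?thesis using self_reproducing_trivial[OF assms(1)] by blast
qed

text \<open>
  With \<open>z = [x, w]\<close>, the matrix of \<open>ad\<^sub>x\<close> on the span of \<open>w, z\<close> is a companion matrix, given by
  \<open>[x, z] = a w + b z\<close>. Nilpotency makes it singular, so \<open>a = 0\<close>, and then forbids the
  eigenvalue \<open>b\<close> unless \<open>b = 0\<close>.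
\<close>

lemma ad_square_zero_on_plane:
  assumes nil: "nilpotent"
    and z: "bracket x w \<noteq> 0"
    and plane: "range (bracket x) \<subseteq> span {w, bracket x w}"
  shows "bracket x (bracket x w) = 0"
proof -
  let ?z = "bracket x w"
  have "bracket x ?z \<in> span {w, ?z}" using plane by blast
  then obtain a b where ab: "bracket x ?z = scale a w + scale b ?z"
    unfolding span_breakdown_eq by (auto simp: algebra_simps)
  have "a = 0"
  proof (rule ccontr)
    assume "a \<noteq> 0"
    \<comment> \<open>Then \<open>w\<close> is recovered from \<open>[x, w]\<close> and \<open>[x, z]\<close>, so \<open>{w, z}\<close> reproduces itself.\<close>
    let ?A = "{w, ?z}"
    have gen: "bracket x c \<in> span {bracket u a | u a. a \<in> ?A}" if "c \<in> ?A" for c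
      using that by (intro span_base) blast
    have "w = scale (1 / a) (bracket x ?z - scale b ?z)"
      using ab \<open>a \<noteq> 0\<close> by simp
    also have "\<dots> \<in> span {bracket u a | u a. a \<in> ?A}"
      by (intro span_scale span_diff gen) auto
    finally have "?A \<subseteq> span {bracket u a | u a. a \<in> ?A}" using gen by blast
    then show False using self_reproducing_trivial[OF nil] z by blast
  qed
  with ab have eig: "bracket x ?z = scale b ?z" by simp
  show ?thesis
  proof (cases "b = 0")
    case False
    then have "?z = bracket x (scale (1 / b) ?z)" using eig by (simp add: bracket_bilinear)
    then have "?z = 0" by (rule ad_no_eigenvector[OF nil])
    with z show ?thesis by contradiction
  qed (use eig in simp)
qed

end

text \<open>A space with no finite basis is assigned dimension \<open>0\<close>, since infinite sets have cardinality \<open>0\<close>.\<close>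

lemma (in vector_space) finite_dimensional_if_dim_pos:
  assumes "dim UNIV > 0"
  obtains B where "finite_dimensional_vector_space scale B"
proof -
  obtain B where "B \<subseteq> UNIV" "independent B" "UNIV \<subseteq> span B" "card B = dim UNIV"
    by (rule basis_exists)
  then have "finite_dimensional_vector_space scale B"
    using assms by unfold_locales (auto intro: card_ge_0_finite)
  then show ?thesis by (rule that)
qed

locale finite_dimensional_lie_algebra =
  lie_algebra scale bracket + finite_dimensional_vector_space scale B
  for scale :: "'f::field \<Rightarrow> 'v::ab_group_add \<Rightarrow> 'v" and bracket and B
begin

lemma breadth_attained: "\<exists>x. dim (range (bracket x)) = breadth"
proof -
  have "range (\<lambda>x. dim (range (ad x))) \<subseteq> {..dimension}"
    using dim_subset_UNIV by auto
  then have "finite (range (\<lambda>x. dim (range (ad x))))"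
    by (rule finite_subset) simp
  then have "breadth \<in> range (\<lambda>x. dim (range (ad x)))"
    unfolding breadth_def by (intro Max_in) auto
  then show ?thesis by (auto simp: ad_def)
qed

text \<open>
  If \<open>ad\<^sub>x\<^sup>2 = 0\<close>, then \<open>x\<close>, a basis \<open>p, q\<close> of the image and preimages \<open>u, v\<close> of \<open>p, q\<close>
  would be five independent vectors: nilpotency keeps \<open>x\<close> out of the image, and \<open>ad\<^sub>x\<close> kills
  \<open>x, p, q\<close> while sending \<open>u, v\<close> to independent vectors.
\<close>

lemma ad_square_nonzero:
  assumes nil: "nilpotent" and dim4: "dim (UNIV :: 'v set) = 4"
    and rank: "dim (range (bracket x)) = 2"
  shows "\<exists>y. bracket x (bracket x y) \<noteq> 0"
proof (rule ccontr)
  assume "\<not> ?thesis"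
  then have sq: "bracket x (bracket x y) = 0" for y by blast
  let ?W = "range (bracket x)"
  have span_W: "span ?W = ?W" by (simp add: span_eq_iff subspace_range_ad)
  have "x \<noteq> 0"
  proof
    assume "x = 0"
    then have "?W \<subseteq> {0}" by (auto simp: bracket_bilinear)
    then have "dim ?W = 0" by (simp only: dim_eq_0)
    with rank show False by simp
  qed
  have x: "x \<notin> span ?W"
  proof
    assume "x \<in> span ?W"
    then obtain u where u: "x = bracket x u" unfolding span_W by blast
    have "bracket u (scale (-1) x) = bracket x u"
      using bracket_antisym[of x u] by (simp add: bracket_bilinear)
    then have "x = bracket u (scale (-1) x)" using u by metis
    then show False using ad_no_eigenvector[OF nil] \<open>x \<noteq> 0\<close> by blast
  qed
  have killed: "bracket x t = 0" if "t \<in> span (insert x ?W)" for t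
    using _ that by (rule span_subset_ker_ad) (auto simp: sq bracket_self)
  have "\<not> ?W \<subseteq> {0}" using rank by (metis dim_eq_0 zero_neq_numeral)
  then obtain u where u: "bracket x u \<noteq> 0" by blast
  have "\<not> ?W \<subseteq> span {bracket x u}"
  proof
    assume "?W \<subseteq> span {bracket x u}"
    then have "dim ?W \<le> dim {bracket x u}" by (rule dim_mono)
    with rank show False by (simp split: if_splits)
  qed
  then obtain v where v: "bracket x v \<notin> span {bracket x u}" by blast
  have u_new: "u \<notin> span (insert x ?W)" using killed u by blast
  have v_new: "v \<notin> span (insert u (insert x ?W))"
  proof
    assume "v \<in> span (insert u (insert x ?W))"
    then obtain k where "v - scale k u \<in> span (insert x ?W)"
      unfolding span_breakdown_eq[of v u] by blast
    then have "bracket x v = scale k (bracket x u)"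
      using killed[of "v - scale k u"] by (simp add: bracket_bilinear)
    then show False using v by (simp add: span_base span_scale)
  qed
  have "dim (insert v (insert u (insert x ?W))) = 5"
    using x u_new v_new rank by (simp add: dim_insert)
  moreover have "dim (insert v (insert u (insert x ?W))) \<le> 4"
    using dim_subset[of _ UNIV] unfolding dim4 by blast
  ultimately show False by simp
qed

text \<open>
  Independence is seen one vector at a time: \<open>x\<close> is not a multiple of \<open>z = [x, w]\<close> by nilpotency, and
  \<open>ad\<^sub>x\<close> detects \<open>w\<close> modulo \<open>x, z\<close> and \<open>y\<close> modulo \<open>w, x, z\<close>. The generator \<open>y\<close> may be any
  preimage of \<open>w\<close>, which also covers the corrected \<open>y - d x\<close>.
\<close>

lemma ad_chain_basis:
  assumes nil: "nilpotent" and dim4: "dim (UNIV :: 'v set) = 4"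
    and w: "bracket x y = w" and z: "bracket x w = z" and xz: "bracket x z = 0"
    and nz: "z \<noteq> 0"
  shows "distinct [x, y, w, z]" "independent {x, y, w, z}" "span {x, y, w, z} = UNIV"
proof -
  have "x \<noteq> 0" using nz z by (auto simp: bracket_bilinear)
  have x: "x \<notin> span {z}"
  proof
    assume "x \<in> span {z}"
    then obtain k where k: "x = scale k z" by (auto simp: span_singleton)
    have "bracket (scale (-1) w) (scale k x) = scale k z"
      using bracket_antisym[of x w] z by (simp add: bracket_bilinear)
    then have "x = bracket (scale (-1) w) (scale k x)" using k by metis
    then show False using ad_no_eigenvector[OF nil] \<open>x \<noteq> 0\<close> by blast
  qed
  have killed: "bracket x t = 0" if "t \<in> span {x, z}" for t
    using _ that by (rule span_subset_ker_ad) (auto simp: xz bracket_self)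
  have w_new: "w \<notin> span {x, z}" using killed nz z by blast
  have y_new: "y \<notin> span {w, x, z}"
  proof
    assume "y \<in> span {w, x, z}"
    then obtain k where "y - scale k w \<in> span {x, z}"
      unfolding span_breakdown_eq[of y w] by blast
    then have "w = scale k z" using killed[of "y - scale k w"] by (simp add: bracket_bilinear w z)
    then show False using w_new by (simp add: span_base span_scale)
  qed
  have "independent {y, w, x, z}"
    using nz x w_new y_new by (intro independent_insertI independent_empty) auto
  moreover have "{y, w, x, z} = {x, y, w, z}" by blast
  ultimately show indep: "independent {x, y, w, z}" by simp
  have dist: "x \<noteq> z" "w \<notin> {x, z}" "y \<notin> {w, x, z}"
    using x w_new y_new by (auto simp: span_base)
  then show "distinct [x, y, w, z]" by auto
  have "card {x, y, w, z} = 4" using dist by auto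
  then show "span {x, y, w, z} = UNIV"
    using card_ge_dim_independent[OF subset_UNIV indep] dim4 by auto
qed

text \<open>
  The Jacobi identity expresses \<open>[y, z] = [x, [y, w]]\<close> and \<open>[w, z] = [x, [y, z]]\<close> through the
  coordinates of \<open>[y, w]\<close>. Each coordinate other than the one along \<open>z\<close> then appears as an
  eigenvalue: \<open>b\<close> of \<open>ad\<^sub>w\<close> and, once it is gone, \<open>c\<close> of \<open>ad\<^sub>y\<close>, both at \<open>z\<close>, and
  finally \<open>- a\<close> of \<open>ad\<^sub>y\<^sup>2\<close> at \<open>w\<close>. Nilpotency makes all of them vanish.
\<close>

lemma bracket_y_w_multiple_of_z:
  assumes nil: "nilpotent"
    and w: "bracket x y = w" and z: "bracket x w = z" and xz: "bracket x z = 0"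
    and nz: "z \<noteq> 0" and basis: "span {x, y, w, z} = UNIV"
  obtains d where "bracket y w = scale d z" "bracket y z = 0" "bracket w z = 0"
proof -
  have "bracket y w \<in> span {x, y, w, z}" using basis by simp
  then obtain a b c d where
    "bracket y w - scale a x - scale b y - scale c w - scale d z = 0"
    unfolding span_breakdown_eq by auto
  then have yw: "bracket y w = scale a x + scale b y + scale c w + scale d z"
    by (simp add: algebra_simps)
  have wx: "bracket w x = - z" and zx: "bracket z x = 0" and yx: "bracket y x = - w"
    using bracket_antisym[of w x] bracket_antisym[of z x] bracket_antisym[of y x] w z xz
    by auto
  have "bracket y z = bracket x (bracket y w)"
    using jacobi[of x y w] by (simp add: w wx bracket_minus_right bracket_self)
  also have "\<dots> = scale b w + scale c z"
    unfolding yw by (simp add: bracket_bilinear bracket_self w z xz)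
  finally have yz: "bracket y z = scale b w + scale c z" .
  have "bracket x (bracket y z) + bracket z w = 0"
    using jacobi[of x y z] by (simp add: w zx bracket_zero_right)
  then have "bracket w z = bracket x (bracket y z)"
    unfolding bracket_antisym[of w z] by (metis eq_neg_iff_add_eq_0)
  also have "\<dots> = scale b z" unfolding yz by (simp add: bracket_bilinear z xz)
  finally have wz: "bracket w z = scale b z" .
  have eigenvalue: "k = 0" if "bracket u z = scale k z" for u k
  proof (rule ccontr)
    assume "k \<noteq> 0"
    then have "z = bracket u (scale (1 / k) z)" using that by (simp add: bracket_bilinear)
    then show False using ad_no_eigenvector[OF nil] nz by blast
  qed
  have b: "b = 0" using eigenvalue wz .
  have c: "c = 0" using eigenvalue yz b by simp
  have yz0: "bracket y z = 0" using yz b c by simp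
  have "w \<noteq> 0" using z nz by (auto simp: bracket_bilinear)
  have a: "a = 0"
  proof (rule ccontr)
    assume "a \<noteq> 0"
    have "bracket y (bracket y w) = scale (- a) w"
      unfolding yw by (simp add: b c bracket_bilinear yx yz0)
    then have "w = scale (- 1 / a) (bracket y (bracket y w))" using \<open>a \<noteq> 0\<close> by simp
    then show False using ad_square_no_eigenvector[OF nil] \<open>w \<noteq> 0\<close> by blast
  qed
  show ?thesis by (rule that[of d]) (use yw yz0 wz a b c in simp_all)
qed

text \<open>
  Since \<open>w\<close> and \<open>z\<close> are independent vectors in the image of \<open>ad\<^sub>x\<close>, rank \<open>2\<close> makes them span it.
  Replacing \<open>y\<close> by \<open>y - d x\<close> keeps \<open>[x, y] = w\<close> because \<open>[x, x] = 0\<close>, keeps \<open>[y, z] = 0\<close>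
  because \<open>[x, z] = 0\<close>, and subtracts \<open>d z\<close> from \<open>[y, w]\<close>.
\<close>

lemma filiform_basis:
  assumes nil: "nilpotent" and dim4: "dim (UNIV :: 'v set) = 4" and br: "breadth = 2"
  shows "\<exists>x1 x2 x3 z. distinct [x1, x2, x3, z] \<and> independent {x1, x2, x3, z} \<and>
    span {x1, x2, x3, z} = UNIV \<and> bracket x1 x2 = x3 \<and> bracket x1 x3 = z \<and>
    bracket x1 z = 0 \<and> bracket x2 x3 = 0 \<and> bracket x2 z = 0 \<and> bracket x3 z = 0"
proof -
  obtain x where rank: "dim (range (bracket x)) = 2" using breadth_attained br by auto
  obtain y where nz: "bracket x (bracket x y) \<noteq> 0"
    using ad_square_nonzero[OF nil dim4 rank] by blast
  define w where "w = bracket x y"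
  define z where "z = bracket x w"
  have nz: "z \<noteq> 0" using nz by (simp add: z_def w_def)
  have w_new: "w \<notin> span {z}"
  proof
    assume "w \<in> span {z}"
    then obtain k where k: "w = scale k z" by (auto simp: span_singleton)
    have "bracket x (scale k w) = scale k z" by (simp add: z_def bracket_bilinear)
    then have "w = bracket x (scale k w)" using k by metis
    then have "w = 0" by (rule ad_no_eigenvector[OF nil])
    with nz show False by (simp add: z_def bracket_bilinear)
  qed
  have "dim {w, z} = 2" using w_new nz by (simp add: dim_insert)
  then have "span {w, z} = span (range (bracket x))"
    using rank by (intro dim_eq_span) (auto simp: w_def z_def)
  then have "range (bracket x) \<subseteq> span {w, z}" using span_superset by blast
  then have xz: "bracket x z = 0"
    using ad_square_zero_on_plane[OF nil, of x w] nz by (simp add: z_def)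
  have "span {x, y, w, z} = UNIV"
    using ad_chain_basis(3)[OF nil dim4 w_def[symmetric] z_def[symmetric] xz nz] .
  then obtain d where d: "bracket y w = scale d z" and yz: "bracket y z = 0"
    and wz: "bracket w z = 0"
    using bracket_y_w_multiple_of_z[OF nil w_def[symmetric] z_def[symmetric] xz nz] by blast
  define y' where "y' = y - scale d x"
  have w': "bracket x y' = w" by (simp add: y'_def w_def bracket_bilinear bracket_self)
  have "bracket y' w = 0" "bracket y' z = 0"
    using d yz xz by (simp_all add: y'_def z_def bracket_bilinear)
  with w' z_def[symmetric] xz wz ad_chain_basis[OF nil dim4 w' z_def[symmetric] xz nz]
  show ?thesis by blast
qed

end

theorem theorem4p1:
  fixes scale :: "'f::field \<Rightarrow> 'v::ab_group_add \<Rightarrow> 'v"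
    and bracket :: "'v \<Rightarrow> 'v \<Rightarrow> 'v"
  assumes "CHAR('f) \<noteq> 2"
    and "lie_algebra scale bracket"
    and "vector_space.dim scale (UNIV :: 'v set) = 4"
    and "lie_algebra.nilpotent scale bracket"
    and "lie_algebra.breadth scale bracket = 2"
  shows "\<exists>x1 x2 x3 z.
    distinct [x1, x2, x3, z] \<and>
    \<not> module.dependent scale {x1, x2, x3, z} \<and>
    module.span scale {x1, x2, x3, z} = UNIV \<and>
    bracket x1 x2 = x3 \<and>
    bracket x1 x3 = z \<and>
    bracket x1 z = 0 \<and>
    bracket x2 x3 = 0 \<and>
    bracket x2 z = 0 \<and>
    bracket x3 z = 0"
proof -
  interpret lie_algebra scale bracket by fact
  obtain B where "finite_dimensional_vector_space scale B"
    using finite_dimensional_if_dim_pos assms(3) by auto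
  then interpret finite_dimensional_lie_algebra scale bracket B
    by (intro finite_dimensional_lie_algebra.intro lie_algebra_axioms)
  show ?thesis using filiform_basis assms(3,4,5) by blast
qed

end
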